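(* Let $G$ be a finite, simple, connected graph and let $D\subseteq V(G)$ be a connected two-way two-step dominating set of $G$. Then $$pc(G)\leq pc(G[D])+2.$$
   Context: For an edge-colored graph, a path is a proper path if no two adjacent (consecutive) edges of the path receive the same color. An edge-coloring of a connected graph $G$ is a proper-path coloring if every pair of distinct vertices $u,v$ is joined by a proper $u$-$v$ path. The proper connection number $pc(G)$ is the minimum number of colors in a proper-path coloring of $G$. $G[D]$ denotes the subgraph induced by $D$. For $S\subseteq V(G)$, $d(v,S)=\min_{x\in S} d(v,x)$ and $N^k(S)=\{x\in V(G): d(x,S)=k\}$. A pendant vertex is a vertex of degree 1. A set $D$ is a two-step dominating set if every vertex of $G$ is at distance at most 2 from $D$. A two-step dominating set $D$ is a two-way two-step dominating set if (i) every pendant vertex of $G$ lies in $D$, and (ii) every vertex in $N^2(D)$ has at least two neighbors in $N^1(D)$. It is connected if $G[D]$ is connected. *)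

theory Defs
  imports Main
begin

text \<open>A graph is a vertex set \<open>V\<close> together with a set \<open>E\<close> of two-element subsets of \<open>V\<close>.\<close>

definition fin_simple_graph :: "'a set \<Rightarrow> 'a set set \<Rightarrow> bool" where
  "fin_simple_graph V E \<longleftrightarrow> finite V \<and> (\<forall>e\<in>E. e \<subseteq> V \<and> card e = 2)"

definition induced_edges :: "'a set set \<Rightarrow> 'a set \<Rightarrow> 'a set set" where
  "induced_edges E D = {e \<in> E. e \<subseteq> D}"

definition neighbors :: "'a set \<Rightarrow> 'a set set \<Rightarrow> 'a \<Rightarrow> 'a set" where
  "neighbors V E v = {w \<in> V. {v, w} \<in> E}"

definition pendant :: "'a set \<Rightarrow> 'a set set \<Rightarrow> 'a \<Rightarrow> bool" where
  "pendant V E v \<longleftrightarrow> v \<in> V \<and> card (neighbors V E v) = 1"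

definition is_path :: "'a set \<Rightarrow> 'a set set \<Rightarrow> 'a \<Rightarrow> 'a list \<Rightarrow> 'a \<Rightarrow> bool" where
  "is_path V E u p v \<longleftrightarrow>
     p \<noteq> [] \<and> hd p = u \<and> last p = v \<and> distinct p \<and> set p \<subseteq> V \<and>
     successively (\<lambda>x y. {x, y} \<in> E) p"

definition connected_graph :: "'a set \<Rightarrow> 'a set set \<Rightarrow> bool" where
  "connected_graph V E \<longleftrightarrow> V \<noteq> {} \<and> (\<forall>u\<in>V. \<forall>v\<in>V. \<exists>p. is_path V E u p v)"

fun path_edges :: "'a list \<Rightarrow> 'a set list" where
  "path_edges (x # y # zs) = {x, y} # path_edges (y # zs)"
| "path_edges _ = []"

definition proper_path ::
  "'a set \<Rightarrow> 'a set set \<Rightarrow> ('a set \<Rightarrow> nat) \<Rightarrow> 'a \<Rightarrow> 'a list \<Rightarrow> 'a \<Rightarrow> bool" where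
  "proper_path V E c u p v \<longleftrightarrow>
     is_path V E u p v \<and> successively (\<lambda>e f. c e \<noteq> c f) (path_edges p)"

definition proper_path_coloring :: "'a set \<Rightarrow> 'a set set \<Rightarrow> ('a set \<Rightarrow> nat) \<Rightarrow> bool" where
  "proper_path_coloring V E c \<longleftrightarrow>
     (\<forall>u\<in>V. \<forall>v\<in>V. u \<noteq> v \<longrightarrow> (\<exists>p. proper_path V E c u p v))"

text \<open>
  The proper connection number: the least \<open>k\<close> for which some \<open>c : E \<rightarrow> {1, \<dots>, k}\<close> is a
  proper-path coloring. The color set is nonempty, so \<open>pc(K\<^sub>1) = 1\<close>, in accordance with the
  usual fact that \<open>pc(G) = 1\<close> holds exactly for complete \<open>G\<close>.  Only meaningful for
  connected graphs.
\<close>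

definition pc :: "'a set \<Rightarrow> 'a set set \<Rightarrow> nat" where
  "pc V E = (LEAST k. 1 \<le> k \<and> (\<exists>c. c ` E \<subseteq> {1..k} \<and> proper_path_coloring V E c))"

text \<open>The following distances are only meaningful in connected graphs, and \<open>set_dist\<close>
  only for finite nonempty \<open>S\<close>.\<close>

definition graph_dist :: "'a set \<Rightarrow> 'a set set \<Rightarrow> 'a \<Rightarrow> 'a \<Rightarrow> nat" where
  "graph_dist V E u v = (LEAST n. \<exists>p. is_path V E u p v \<and> length (path_edges p) = n)"

definition set_dist :: "'a set \<Rightarrow> 'a set set \<Rightarrow> 'a \<Rightarrow> 'a set \<Rightarrow> nat" where
  "set_dist V E v S = Min (graph_dist V E v ` S)"

definition nbhd_at :: "'a set \<Rightarrow> 'a set set \<Rightarrow> nat \<Rightarrow> 'a set \<Rightarrow> 'a set" where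
  "nbhd_at V E k S = {x \<in> V. set_dist V E x S = k}"

definition two_step_dominating :: "'a set \<Rightarrow> 'a set set \<Rightarrow> 'a set \<Rightarrow> bool" where
  "two_step_dominating V E D \<longleftrightarrow>
     D \<subseteq> V \<and> D \<noteq> {} \<and> (\<forall>v\<in>V. set_dist V E v D \<le> 2)"

definition two_way_two_step_dominating :: "'a set \<Rightarrow> 'a set set \<Rightarrow> 'a set \<Rightarrow> bool" where
  "two_way_two_step_dominating V E D \<longleftrightarrow>
     two_step_dominating V E D \<and>
     (\<forall>v. pendant V E v \<longrightarrow> v \<in> D) \<and>
     (\<forall>v \<in> nbhd_at V E 2 D. 2 \<le> card (neighbors V E v \<inter> nbhd_at V E 1 D))"

definition connected_two_way_two_step_dominating ::
  "'a set \<Rightarrow> 'a set set \<Rightarrow> 'a set \<Rightarrow> bool" where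
  "connected_two_way_two_step_dominating V E D \<longleftrightarrow>
     two_way_two_step_dominating V E D \<and> connected_graph D (induced_edges E D)"

end

theory Submission
  imports Defs
begin

text \<open>
  Color \<open>G[D]\<close> optimally with \<open>k\<close> colors and let \<open>a\<close>, \<open>b\<close> be two new ones.  Link two vertices of
  \<open>N\<^sup>1(D)\<close> if they are adjacent or have a common neighbor in \<open>N\<^sup>2(D)\<close>, and label \<open>N\<^sup>1(D)\<close> with
  \<open>a\<close> and \<open>b\<close> so that every vertex with a link has a link to the opposite label.  An unlinked
  vertex has two neighbors in \<open>D\<close>, since it is not pendant; its edges to \<open>D\<close> receive both new
  colors.  All edges from a linked vertex to \<open>D\<close> receive its label, edges within \<open>N\<^sup>1(D)\<close> receive
  color 1, and an edge from \<open>p \<in> N\<^sup>1(D)\<close> to \<open>w \<in> N\<^sup>2(D)\<close> receives the label opposite to that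
  of \<open>p\<close>, except that a \<open>w\<close> whose neighbors in \<open>N\<^sup>1(D)\<close> all have the same label has one marked
  neighbor, whose edge to \<open>w\<close> receives that label.  Then from every vertex outside \<open>D\<close> there are
  proper paths entering \<open>D\<close> by an edge of color \<open>a\<close> and by one of color \<open>b\<close>.  Disjoint paths
  entering with different new colors are joined by a proper path within \<open>D\<close>; where disjointness
  fails, the two vertices are adjacent or joined by a proper path of length two.
\<close>

section \<open>Edge lists of paths\<close>

lemma path_edges_snoc: "xs \<noteq> [] \<Longrightarrow> path_edges (xs @ [x]) = path_edges xs @ [{last xs, x}]"
  by (induction xs rule: path_edges.induct) auto

lemma path_edges_append:
  "xs \<noteq> [] \<Longrightarrow> ys \<noteq> [] \<Longrightarrow>
    path_edges (xs @ ys) = path_edges xs @ {last xs, hd ys} # path_edges ys"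
proof (induction xs rule: path_edges.induct)
  case ("2_2" v)
  then show ?case by (cases ys) auto
qed auto

lemma path_edges_rev: "path_edges (rev xs) = rev (path_edges xs)"
proof (induction xs rule: path_edges.induct)
  case (1 x y zs)
  then show ?case
    using path_edges_snoc[of "rev zs @ [y]" x] by (auto simp: insert_commute)
qed auto

lemma set_path_edges_subset:
  "successively (\<lambda>x y. {x, y} \<in> E) p \<Longrightarrow> set (path_edges p) \<subseteq> E"
  by (induction p rule: path_edges.induct) auto

lemma length_path_edges: "length (path_edges p) = length p - 1"
  by (induction p rule: path_edges.induct) auto

text \<open>\<open>{x, y} = {y, z}\<close> would force \<open>x = z\<close>. This makes every path
  proper under an injective coloring.\<close>

lemma path_edges_distinct_successively:
  "distinct p \<Longrightarrow> successively (\<noteq>) (path_edges p)"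
proof (induction p rule: path_edges.induct)
  case (1 x y zs)
  then show ?case by (cases zs) (auto simp: doubleton_eq_iff)
qed auto

lemma proper_path_rev:
  assumes "proper_path V E c u p v"
  shows "proper_path V E c v (rev p) u"
proof -
  have "successively (\<lambda>x y. {y, x} \<in> E) p"
    using assms unfolding proper_path_def is_path_def by (simp add: insert_commute)
  moreover have "successively (\<lambda>e f. c f \<noteq> c e) (path_edges p)"
    using assms unfolding proper_path_def by (metis (mono_tags, lifting) successively_mono)
  ultimately show ?thesis
    using assms unfolding proper_path_def is_path_def
    by (simp add: hd_rev last_rev path_edges_rev)
qed

lemma proper_path_edge:
  assumes "{u, v} \<in> E" "u \<noteq> v" "u \<in> V" "v \<in> V"
  shows "proper_path V E c u [u, v] v"
  using assms by (auto simp: proper_path_def is_path_def)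

section \<open>Colorings attaining the proper connection number\<close>

text \<open>Giving all edges different colors makes every path proper. The witness ensures that the
  \<open>LEAST\<close> in \<open>pc\<close> is attained.\<close>

lemma connected_graph_imp_proper_path_coloring:
  assumes "finite E" "connected_graph V E"
  shows "\<exists>k\<ge>1. \<exists>c. c ` E \<subseteq> {1..k} \<and> proper_path_coloring V E c"
proof -
  obtain h :: "'a set \<Rightarrow> nat" where h: "bij_betw h E {0..<card E}"
    using ex_bij_betw_finite_nat[OF assms(1)] by blast
  define c where "c e = Suc (h e)" for e
  have inj: "inj_on c E" using h by (auto simp: c_def bij_betw_def inj_on_def)
  have "h e < card E" if "e \<in> E" for e using bij_betwE[OF h] that by auto
  \<comment> \<open>The bound is \<open>card E + 1\<close> because \<open>k \<ge> 1\<close> is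
    required even when \<open>E\<close> is empty.\<close>
  then have "c ` E \<subseteq> {1..card E + 1}" by (auto simp: c_def less_imp_le)
  moreover have "proper_path_coloring V E c"
    unfolding proper_path_coloring_def
  proof (intro ballI impI)
    fix u v assume "u \<in> V" "v \<in> V"
    then obtain p where p: "is_path V E u p v"
      using assms(2) unfolding connected_graph_def by blast
    have sub: "set (path_edges p) \<subseteq> E"
      using p set_path_edges_subset unfolding is_path_def by blast
    have "successively (\<noteq>) (path_edges p)"
      using p path_edges_distinct_successively unfolding is_path_def by blast
    then have "successively (\<lambda>e f. c e \<noteq> c f) (path_edges p)"
      by (rule successively_mono) (use inj sub in \<open>auto simp: inj_on_def\<close>)
    then show "\<exists>p. proper_path V E c u p v"
      using p unfolding proper_path_def by blast
  qed
  ultimately show ?thesis by (intro exI[of _ "card E + 1"]) auto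
qed

lemma pc_attained:
  assumes "finite E" "connected_graph V E"
  obtains c where "1 \<le> pc V E" "c ` E \<subseteq> {1..pc V E}" "proper_path_coloring V E c"
  using LeastI_ex[OF connected_graph_imp_proper_path_coloring[OF assms, unfolded Bex_def]]
  unfolding pc_def by blast

lemma pc_le:
  assumes "1 \<le> k" "c ` E \<subseteq> {1..k}" "proper_path_coloring V E c"
  shows "pc V E \<le> k"
  unfolding pc_def by (rule Least_le) (use assms in blast)

section \<open>Distances to a vertex and to a set\<close>

lemma graph_dist_attained:
  assumes "connected_graph V E" "u \<in> V" "v \<in> V"
  obtains p where "is_path V E u p v" "length (path_edges p) = graph_dist V E u v"
proof -
  have "\<exists>n p. is_path V E u p v \<and> length (path_edges p) = n"
    using assms unfolding connected_graph_def by blast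
  from LeastI_ex[OF this] show ?thesis using that unfolding graph_dist_def by blast
qed

lemma graph_dist_eq_0_iff:
  assumes "connected_graph V E" "u \<in> V" "v \<in> V"
  shows "graph_dist V E u v = 0 \<longleftrightarrow> u = v"
proof
  assume "graph_dist V E u v = 0"
  then obtain p where "is_path V E u p v" "length (path_edges p) = 0"
    using graph_dist_attained[OF assms] by metis
  then show "u = v" by (cases p) (auto simp: is_path_def length_path_edges)
next
  assume "u = v"
  then have "is_path V E u [u] v \<and> length (path_edges [u]) = 0"
    using assms by (auto simp: is_path_def)
  then show "graph_dist V E u v = 0"
    unfolding graph_dist_def by (intro Least_eq_0) blast
qed

lemma graph_dist_eq_1_imp_edge:
  assumes "connected_graph V E" "u \<in> V" "v \<in> V" "graph_dist V E u v = 1"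
  shows "{u, v} \<in> E"
proof -
  obtain p where "is_path V E u p v" "length (path_edges p) = 1"
    using graph_dist_attained[OF assms(1-3)] assms(4) by metis
  then show ?thesis
    by (cases p rule: path_edges.cases) (auto simp: is_path_def length_path_edges split: if_splits)
qed

lemma set_dist_attained:
  assumes "finite S" "S \<noteq> {}"
  obtains x where "x \<in> S" "set_dist V E v S = graph_dist V E v x"
proof -
  have "set_dist V E v S \<in> graph_dist V E v ` S"
    unfolding set_dist_def using assms by (intro Min_in) auto
  then show ?thesis using that by blast
qed

lemma set_dist_eq_0_iff:
  assumes "connected_graph V E" "finite S" "S \<noteq> {}" "S \<subseteq> V" "v \<in> V"
  shows "set_dist V E v S = 0 \<longleftrightarrow> v \<in> S"
proof
  assume "set_dist V E v S = 0"
  then show "v \<in> S"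
    using set_dist_attained[OF assms(2,3)] graph_dist_eq_0_iff assms by (metis subsetD)
next
  assume "v \<in> S"
  then have "set_dist V E v S \<le> graph_dist V E v v"
    unfolding set_dist_def using assms by auto
  then show "set_dist V E v S = 0"
    using graph_dist_eq_0_iff[OF assms(1,5,5)] by simp
qed

section \<open>Splitting along a symmetric relation\<close>

text \<open>One side of the splitting is a maximal independent set.\<close>

lemma splitting_without_monochromatic_neighborhoods:
  assumes "finite N" "\<And>p q. R p q \<Longrightarrow> R q p" "\<And>p q. R p q \<Longrightarrow> p \<noteq> q"
  obtains I where
    "\<And>p q. \<lbrakk>p \<in> N; q \<in> N; R p q\<rbrakk> \<Longrightarrow> \<exists>r\<in>N. R p r \<and> (r \<in> I \<longleftrightarrow> p \<notin> I)"
proof -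
  let ?S = "{I. I \<subseteq> N \<and> (\<forall>p\<in>I. \<forall>q\<in>I. \<not> R p q)}"
  have "finite ?S" using assms(1) by simp
  moreover have "{} \<in> ?S" by simp
  ultimately obtain I where I: "I \<in> ?S" and max: "\<And>J. J \<in> ?S \<Longrightarrow> I \<subseteq> J \<Longrightarrow> I = J"
    using finite_has_maximal[of ?S] by (metis (no_types, lifting) empty_iff)
  have "\<exists>r\<in>N. R p r \<and> (r \<in> I \<longleftrightarrow> p \<notin> I)" if pq: "p \<in> N" "q \<in> N" "R p q" for p q
  proof (cases "p \<in> I")
    case True
    \<comment> \<open>Independence puts \<open>q\<close> itself outside \<open>I\<close>.\<close>
    then show ?thesis using pq I by blast
  next
    case False
    \<comment> \<open>If \<open>p\<close> were related to no element of \<open>I\<close>, then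
      \<open>insert p I\<close> would be a larger independent set.\<close>
    then have "insert p I \<notin> ?S" using max[of "insert p I"] by blast
    then obtain r where "r \<in> I" "R p r" using I pq(1) assms(2) assms(3)[of p p] by auto
    then show ?thesis using False I by blast
  qed
  then show ?thesis using that by blast
qed


section \<open>The coloring of the two layers around \<open>D\<close>\<close>

definition linked :: "'a set set \<Rightarrow> 'a set \<Rightarrow> 'a \<Rightarrow> 'a \<Rightarrow> bool" where
  "linked E W p q \<longleftrightarrow> p \<noteq> q \<and> ({p, q} \<in> E \<or> (\<exists>w\<in>W. {p, w} \<in> E \<and> {q, w} \<in> E))"

text \<open>Distances are abstracted away: only the partition into layers and the edges guaranteed
  by domination remain. \<open>I\<close> holds the vertices labelled \<open>a\<close>.
  \<open>foot p\<close> and \<open>mark w\<close> are arbitrary fixed choices that single out one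
  edge at \<open>p\<close> and one at \<open>w\<close> for exceptional treatment.\<close>

locale two_layer_coloring =
  fixes V :: "'a set" and E :: "'a set set" and D N1 N2 I :: "'a set"
    and cD :: "'a set \<Rightarrow> nat" and k :: nat and foot mark :: "'a \<Rightarrow> 'a"
  assumes V: "V = D \<union> N1 \<union> N2"
    and disj: "D \<inter> N1 = {}" "D \<inter> N2 = {}" "N1 \<inter> N2 = {}"
    and foot: "\<And>p. p \<in> N1 \<Longrightarrow> foot p \<in> D \<and> {p, foot p} \<in> E"
    and second_foot: "\<And>p. \<lbrakk>p \<in> N1; \<forall>q\<in>N1. \<not> linked E N2 p q\<rbrakk> \<Longrightarrow> \<exists>x\<in>D. x \<noteq> foot p \<and> {p, x} \<in> E"
    and split: "\<And>p q. \<lbrakk>p \<in> N1; q \<in> N1; linked E N2 p q\<rbrakk> \<Longrightarrow> \<exists>r\<in>N1. linked E N2 p r \<and> (r \<in> I \<longleftrightarrow> p \<notin> I)"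
    and mark: "\<And>w. w \<in> N2 \<Longrightarrow> mark w \<in> N1 \<and> {mark w, w} \<in> E"
    and unmarked: "\<And>w. w \<in> N2 \<Longrightarrow> \<exists>p\<in>N1. p \<noteq> mark w \<and> {p, w} \<in> E"
    and k: "1 \<le> k"
    and cD_range: "cD ` induced_edges E D \<subseteq> {1..k}"
    and cD_proper: "proper_path_coloring D (induced_edges E D) cD"
begin

definition isolated :: "'a \<Rightarrow> bool" where
  "isolated p \<longleftrightarrow> (\<forall>q\<in>N1. \<not> linked E N2 p q)"

definition mixed :: "'a \<Rightarrow> bool" where
  "mixed w \<longleftrightarrow> (\<exists>p\<in>N1 \<inter> I. {p, w} \<in> E) \<and> (\<exists>p\<in>N1 - I. {p, w} \<in> E)"

text \<open>Indexing the new colors \<open>a\<close> (\<open>True\<close>) and \<open>b\<close>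
  (\<open>False\<close>) by booleans turns the opposite label into negation.\<close>

definition new_color :: "bool \<Rightarrow> nat" where
  "new_color b = (if b then k + 1 else k + 2)"

text \<open>Edges are sets, so their ends are recovered by intersecting with the layers;
  disjointness of the layers makes these intersections singletons. The default 1 lies in the range
  and differs from both new colors.\<close>

definition c :: "'a set \<Rightarrow> nat" where
  "c e = (if e \<subseteq> D then cD e
     else if e \<inter> N1 \<noteq> {} \<and> e \<inter> D \<noteq> {} then
       (let p = the_elem (e \<inter> N1); x = the_elem (e \<inter> D)
        in new_color (if isolated p \<and> x \<noteq> foot p then p \<notin> I else p \<in> I))
     else if e \<inter> N1 \<noteq> {} \<and> e \<inter> N2 \<noteq> {} then
       (let p = the_elem (e \<inter> N1); w = the_elem (e \<inter> N2)
        in new_color (if \<not> mixed w \<and> p = mark w then p \<in> I else p \<notin> I))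
     else 1)"

lemma new_color_eq_iff [simp]: "new_color a = new_color b \<longleftrightarrow> a = b"
  by (simp add: new_color_def)

lemma new_color_neq_1 [simp]: "new_color a \<noteq> 1" "1 \<noteq> new_color a"
    "new_color a \<noteq> Suc 0" "Suc 0 \<noteq> new_color a"
  using k by (auto simp: new_color_def)

lemma new_color_gt: "k < new_color a"
  by (simp add: new_color_def)

lemma c_within_D: "e \<subseteq> D \<Longrightarrow> c e = cD e"
  by (simp add: c_def)

lemma c_within_N1:
  assumes "p \<in> N1" "q \<in> N1"
  shows "c {p, q} = 1"
proof -
  have "{p, q} \<inter> D = {}" "{p, q} \<inter> N2 = {}" using assms disj by auto
  then show ?thesis by (auto simp: c_def)
qed

lemma c_N1_D:
  assumes "p \<in> N1" "x \<in> D"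
  shows "c {p, x} = new_color (if isolated p \<and> x \<noteq> foot p then p \<notin> I else p \<in> I)"
proof -
  have "{p, x} \<inter> N1 = {p}" "{p, x} \<inter> D = {x}" "\<not> {p, x} \<subseteq> D" using assms disj by auto
  then show ?thesis unfolding c_def by (simp del: insert_subset)
qed

lemma c_N1_N2:
  assumes "p \<in> N1" "w \<in> N2"
  shows "c {p, w} = new_color (if \<not> mixed w \<and> p = mark w then p \<in> I else p \<notin> I)"
proof -
  have "{p, w} \<inter> N1 = {p}" "{p, w} \<inter> N2 = {w}" "{p, w} \<inter> D = {}" "\<not> {p, w} \<subseteq> D"
    using assms disj by auto
  then show ?thesis unfolding c_def by (simp del: insert_subset)
qed

lemma c_N2_N1:
  "p \<in> N1 \<Longrightarrow> w \<in> N2 \<Longrightarrow>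
    c {w, p} = new_color (if \<not> mixed w \<and> p = mark w then p \<in> I else p \<notin> I)"
  using c_N1_N2 by (simp add: insert_commute)

lemma c_range: "c ` E \<subseteq> {1..k + 2}"
proof -
  have "c e \<in> {1..k + 2}" if "e \<in> E" for e
  proof (cases "e \<subseteq> D")
    case True
    then have "cD e \<in> {1..k}" using that cD_range by (auto simp: induced_edges_def)
    then show ?thesis using True by (simp add: c_within_D)
  next
    case False
    then show ?thesis by (auto simp: c_def Let_def new_color_def)
  qed
  then show ?thesis by blast
qed

section \<open>Leaving the outer layers and joining inside \<open>D\<close>\<close>

text \<open>The entry vertex \<open>x\<close> is kept out of \<open>P\<close>, so disjointness of
  two such paths concerns only vertices outside \<open>D\<close>; they may enter \<open>D\<close> at
  the same vertex. \<open>b\<close> records the color of the entering edge.\<close>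

definition exit_path :: "'a \<Rightarrow> 'a list \<Rightarrow> bool \<Rightarrow> bool" where
  "exit_path u P b \<longleftrightarrow> P \<noteq> [] \<and> hd P = u \<and> distinct P \<and> set P \<subseteq> V - D \<and>
     (\<exists>x\<in>D. successively (\<lambda>x y. {x, y} \<in> E) (P @ [x]) \<and>
        successively (\<lambda>e f. c e \<noteq> c f) (path_edges (P @ [x])) \<and> c {last P, x} = new_color b)"

text \<open>The bound \<open>c e \<le> k\<close> lets the path follow any edge of a new color. For
  \<open>x = y\<close> it is the single vertex, without edges.\<close>

lemma path_within_D:
  assumes "x \<in> D" "y \<in> D"
  obtains d where "d \<noteq> []" "hd d = x" "last d = y" "distinct d" "set d \<subseteq> D"
    "successively (\<lambda>x y. {x, y} \<in> E) d" "successively (\<lambda>e f. c e \<noteq> c f) (path_edges d)"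
    "\<And>e. e \<in> set (path_edges d) \<Longrightarrow> c e \<le> k"
proof (cases "x = y")
  case True
  then show ?thesis using that[of "[x]"] assms by auto
next
  case False
  then obtain d where d: "proper_path D (induced_edges E D) cD x d y"
    using cD_proper assms unfolding proper_path_coloring_def by blast
  then have path: "is_path D (induced_edges E D) x d y"
    and col: "successively (\<lambda>e f. cD e \<noteq> cD f) (path_edges d)"
    unfolding proper_path_def by auto
  have sub: "set (path_edges d) \<subseteq> induced_edges E D"
    using path set_path_edges_subset unfolding is_path_def by blast
  have eq: "c e = cD e" "c e \<le> k" if "e \<in> set (path_edges d)" for e
  proof -
    have e: "e \<in> induced_edges E D" using that sub by blast
    then show "c e = cD e" by (simp add: c_within_D induced_edges_def)
    then show "c e \<le> k" using e cD_range by fastforce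
  qed
  have "successively (\<lambda>x y. {x, y} \<in> E) d"
    using path unfolding is_path_def
    by (auto elim!: successively_mono simp: induced_edges_def)
  moreover have "successively (\<lambda>e f. c e \<noteq> c f) (path_edges d)"
    using col by (rule successively_mono) (simp add: eq)
  ultimately show ?thesis
    using that[of d] path eq False unfolding is_path_def by blast
qed

lemma exit_path_to_D:
  assumes "exit_path u P b" "y \<in> D"
  shows "\<exists>p. proper_path V E c u p y"
proof -
  obtain x where P: "P \<noteq> []" "hd P = u" "distinct P" "set P \<subseteq> V - D" and x: "x \<in> D"
    and PE: "successively (\<lambda>x y. {x, y} \<in> E) (P @ [x])"
    and PC: "successively (\<lambda>e f. c e \<noteq> c f) (path_edges (P @ [x]))"
    and b: "c {last P, x} = new_color b"
    using assms(1) unfolding exit_path_def by blast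
  obtain d where d: "d \<noteq> []" "hd d = x" "last d = y" "distinct d" "set d \<subseteq> D"
    "successively (\<lambda>x y. {x, y} \<in> E) d" "successively (\<lambda>e f. c e \<noteq> c f) (path_edges d)"
    "\<And>e. e \<in> set (path_edges d) \<Longrightarrow> c e \<le> k"
    using path_within_D[OF x assms(2)] by metis
  have edges: "path_edges (P @ d) = path_edges (P @ [x]) @ path_edges d"
    using P(1) d(1,2) by (simp add: path_edges_append path_edges_snoc)
  have "last (path_edges (P @ [x])) = {last P, x}" using P(1) by (simp add: path_edges_snoc)
  moreover have "path_edges d \<noteq> [] \<Longrightarrow> c (hd (path_edges d)) \<noteq> new_color b"
    using d(8)[of "hd (path_edges d)"] new_color_gt[of b] by fastforce
  ultimately have "successively (\<lambda>e f. c e \<noteq> c f) (path_edges (P @ d))"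
    unfolding edges using PC d(7) b by (auto simp: successively_append_iff)
  moreover have "successively (\<lambda>x y. {x, y} \<in> E) (P @ d)"
    using PE d(1,2,6) P(1) by (auto simp: successively_append_iff)
  ultimately show ?thesis
    using P d V unfolding proper_path_def is_path_def
    by (intro exI[of _ "P @ d"]) auto
qed

text \<open>If the entry vertices differ, old colors separate the two entering edges. If they
  coincide, the entering edges become consecutive, and it is their opposite colors that keep the
  path proper.\<close>

lemma exit_paths_join:
  assumes "exit_path u P b" "exit_path v Q (\<not> b)" "set P \<inter> set Q = {}"
  shows "\<exists>p. proper_path V E c u p v"
proof -
  obtain x where P: "P \<noteq> []" "hd P = u" "distinct P" "set P \<subseteq> V - D" and x: "x \<in> D"
    and PE: "successively (\<lambda>x y. {x, y} \<in> E) (P @ [x])"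
    and PC: "successively (\<lambda>e f. c e \<noteq> c f) (path_edges (P @ [x]))"
    and b: "c {last P, x} = new_color b"
    using assms(1) unfolding exit_path_def by blast
  obtain y where Q: "Q \<noteq> []" "hd Q = v" "distinct Q" "set Q \<subseteq> V - D" and y: "y \<in> D"
    and QE: "successively (\<lambda>x y. {x, y} \<in> E) (Q @ [y])"
    and QC: "successively (\<lambda>e f. c e \<noteq> c f) (path_edges (Q @ [y]))"
    and b': "c {last Q, y} = new_color (\<not> b)"
    using assms(2) unfolding exit_path_def by blast
  obtain d where d: "d \<noteq> []" "hd d = x" "last d = y" "distinct d" "set d \<subseteq> D"
    "successively (\<lambda>x y. {x, y} \<in> E) d" "successively (\<lambda>e f. c e \<noteq> c f) (path_edges d)"
    "\<And>e. e \<in> set (path_edges d) \<Longrightarrow> c e \<le> k"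
    using path_within_D[OF x y] by metis
  let ?R = "P @ d @ rev Q"
  have QE': "successively (\<lambda>x y. {x, y} \<in> E) (rev (Q @ [y]))"
    unfolding successively_rev using QE by (simp add: insert_commute)
  have QC': "successively (\<lambda>e f. c e \<noteq> c f) (rev (path_edges (Q @ [y])))"
    unfolding successively_rev using QC by (rule successively_mono) auto
  have edges: "path_edges ?R =
      path_edges (P @ [x]) @ path_edges d @ rev (path_edges (Q @ [y]))"
    using P(1) Q(1) d(1-3)
    by (simp add: path_edges_append path_edges_snoc path_edges_rev hd_rev insert_commute)
  have ends: "last (path_edges (P @ [x])) = {last P, x}"
    "hd (rev (path_edges (Q @ [y]))) = {last Q, y}"
    using P(1) Q(1) by (simp_all add: path_edges_snoc)
  have old: "c e \<noteq> new_color a" if "e \<in> set (path_edges d)" for e a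
    using d(8)[OF that] new_color_gt[of a] by simp
  have "successively (\<lambda>e f. c e \<noteq> c f) (path_edges d @ rev (path_edges (Q @ [y])))"
    unfolding successively_append_iff using d(7) QC' ends b' old last_in_set by metis
  moreover have "c (last (path_edges (P @ [x]))) \<noteq>
      c (hd (path_edges d @ rev (path_edges (Q @ [y]))))"
  proof (cases "path_edges d = []")
    case True
    then show ?thesis using ends b b' by simp
  next
    case False
    then show ?thesis using ends(1) b old[OF hd_in_set[OF False], of b] by simp
  qed
  ultimately have "successively (\<lambda>e f. c e \<noteq> c f) (path_edges ?R)"
    unfolding edges using PC by (simp add: successively_append_iff[of _ "path_edges (P @ [x])"])
  moreover have "successively (\<lambda>x y. {x, y} \<in> E) ?R"
    using PE QE' d(1-3,6) P(1) Q(1) by (auto simp: successively_append_iff successively_Cons)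
  ultimately show ?thesis
    using P Q d(1-5) V assms(3) unfolding proper_path_def is_path_def
    by (intro exI[of _ ?R]) (auto simp: last_rev)
qed

section \<open>Construction of exit paths\<close>

lemma exit_direct:
  assumes "p \<in> N1"
  shows "exit_path p [p] (p \<in> I)"
  using assms foot[OF assms] V disj c_N1_D[OF assms]
  unfolding exit_path_def by (auto intro!: bexI[of _ "foot p"])

text \<open>The edge to \<open>foot p\<close> has the label of \<open>p\<close> as its color and
  every other edge into \<open>D\<close> the opposite color; \<open>second_foot\<close> supplies one
  of the latter.\<close>

lemma exit_direct_isolated:
  assumes "p \<in> N1" "isolated p"
  shows "exit_path p [p] b"
proof (cases "b \<longleftrightarrow> p \<in> I")
  case True
  then show ?thesis using exit_direct[OF assms(1)] by simp
next
  case False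
  obtain x where "x \<in> D" "x \<noteq> foot p" "{p, x} \<in> E"
    using second_foot[OF assms(1)] assms(2) unfolding isolated_def by blast
  then show ?thesis
    using False assms V disj c_N1_D[OF assms(1)]
    unfolding exit_path_def by (auto intro!: bexI[of _ x])
qed

text \<open>The edge after \<open>{u, p}\<close> is the one entering \<open>D\<close> when
  \<open>P = [p]\<close>, and the first edge of \<open>P\<close> otherwise; hence the case
  distinction in the color condition.\<close>

lemma exit_path_Cons:
  assumes "exit_path p P b" "u \<in> V - D" "u \<notin> set P" "{u, p} \<in> E"
    and "c {u, p} \<noteq> (if tl P = [] then new_color b else c {p, hd (tl P)})"
  shows "exit_path u (u # P) b"
proof -
  obtain x where P: "P \<noteq> []" "hd P = p" "distinct P" "set P \<subseteq> V - D" and x: "x \<in> D"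
    and PE: "successively (\<lambda>x y. {x, y} \<in> E) (P @ [x])"
    and PC: "successively (\<lambda>e f. c e \<noteq> c f) (path_edges (P @ [x]))"
    and b: "c {last P, x} = new_color b"
    using assms(1) unfolding exit_path_def by blast
  obtain P' where P': "P = p # P'" using P by (cases P) auto
  have "successively (\<lambda>e f. c e \<noteq> c f) (path_edges ((u # P) @ [x]))"
    using PC assms(5) b unfolding P' by (cases P') auto
  then show ?thesis
    using assms P x PE b unfolding exit_path_def
    by (auto simp: successively_Cons intro!: bexI[of _ x])
qed

lemma linked_not_isolated:
  assumes "p \<in> N1" "q \<in> N1" "linked E N2 p q"
  shows "\<not> isolated p" "\<not> isolated q"
  using assms unfolding isolated_def linked_def by (auto simp: insert_commute)

text \<open>\<open>w\<close> has at least two neighbors in \<open>N1\<close>, and it links any two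
  of them.\<close>

lemma N2_neighbor_not_isolated:
  assumes "w \<in> N2" "p \<in> N1" "{p, w} \<in> E"
  shows "\<not> isolated p"
proof -
  obtain q where "q \<in> N1" "{q, w} \<in> E" "q \<noteq> p"
    using unmarked[OF assms(1)] mark[OF assms(1)] by metis
  then have "linked E N2 p q" using assms unfolding linked_def by blast
  then show ?thesis using \<open>q \<in> N1\<close> unfolding isolated_def by blast
qed

text \<open>The first edge avoids the label of \<open>p\<close>, so that a marked edge can be put in front.\<close>

lemma exit_detour:
  assumes "p \<in> N1" "\<not> isolated p"
  obtains P where "exit_path p P (p \<notin> I)" "tl P \<noteq> []" "c {p, hd (tl P)} \<noteq> new_color (p \<in> I)"
    "set P \<subseteq> {p} \<union> {w \<in> N2. mixed w} \<union> {q \<in> N1. \<not> isolated q \<and> (q \<in> I \<longleftrightarrow> p \<notin> I)}"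
proof -
  obtain q where q: "q \<in> N1" "linked E N2 p q" "q \<in> I \<longleftrightarrow> p \<notin> I"
    using assms split unfolding isolated_def by blast
  have iso: "\<not> isolated q" using linked_not_isolated[OF assms(1) q(1,2)] by simp
  have dir: "exit_path q [q] (p \<notin> I)" using exit_direct[OF q(1)] q(3) by simp
  have pV: "p \<in> V - D" using assms(1) V disj by auto
  have "p \<noteq> q" using q(3) by blast
  show ?thesis
  proof (cases "{p, q} \<in> E")
    case True
    have "exit_path p [p, q] (p \<notin> I)"
      using exit_path_Cons[OF dir pV _ True] \<open>p \<noteq> q\<close> c_within_N1[OF assms(1) q(1)] by simp
    then show ?thesis
      using that[of "[p, q]"] q iso c_within_N1[OF assms(1) q(1)] by simp
  next
    case False
    then obtain w where w: "w \<in> N2" "{p, w} \<in> E" "{q, w} \<in> E"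
      using q(2) unfolding linked_def by blast
    \<comment> \<open>\<open>p\<close> and \<open>q\<close> have opposite labels, so no edge at
      \<open>w\<close> is exceptional. Along \<open>p, w, q\<close> and into \<open>D\<close> the
      colors alternate: opposite label of \<open>p\<close>, label of \<open>p\<close>, opposite
      label of \<open>p\<close>.\<close>
    have mixed: "mixed w" using w q(1,3) assms(1) unfolding mixed_def by blast
    have wV: "w \<in> V - D" "w \<noteq> p" "w \<noteq> q" using w(1) assms(1) q(1) V disj by auto
    have cw: "c {w, q} = new_color (p \<in> I)" "c {p, w} = new_color (p \<notin> I)"
      using c_N2_N1[OF q(1) w(1)] c_N1_N2[OF assms(1) w(1)] mixed q(3) by auto
    have "exit_path w [w, q] (p \<notin> I)"
      using exit_path_Cons[OF dir wV(1)] wV w(3) cw by (simp add: insert_commute)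
    then have "exit_path p [p, w, q] (p \<notin> I)"
      using exit_path_Cons[of w "[w, q]" "p \<notin> I" p] pV wV \<open>p \<noteq> q\<close> w(2) cw by simp
    then show ?thesis
      using that[of "[p, w, q]"] q iso w mixed cw by simp
  qed
qed

lemma exit_via_unmarked:
  assumes "w \<in> N2" "p \<in> N1" "{p, w} \<in> E" "mixed w \<or> p \<noteq> mark w"
  shows "exit_path w [w, p] (p \<in> I)"
proof -
  have "w \<in> V - D" "w \<noteq> p" using assms V disj by auto
  then show ?thesis
    using exit_path_Cons[OF exit_direct[OF assms(2)], of w] assms c_N2_N1[OF assms(2,1)]
    by (auto simp: insert_commute)
qed

text \<open>The marked edge has the label of \<open>mark w\<close> as its color, so it is followed
  by a detour from \<open>mark w\<close>, whose first edge avoids that color. The detour meets only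
  mixed vertices of \<open>N2\<close> and therefore misses \<open>w\<close>.\<close>

lemma exit_via_mark:
  assumes "w \<in> N2" "\<not> mixed w"
  obtains P where "exit_path w P (mark w \<notin> I)"
    "set P \<subseteq> {w, mark w} \<union> {v \<in> N2. mixed v} \<union>
      {q \<in> N1. \<not> isolated q \<and> (q \<in> I \<longleftrightarrow> mark w \<notin> I)}"
proof -
  have m: "mark w \<in> N1" "{mark w, w} \<in> E" using mark[OF assms(1)] by auto
  obtain P where P: "exit_path (mark w) P (mark w \<notin> I)" "tl P \<noteq> []"
    "c {mark w, hd (tl P)} \<noteq> new_color (mark w \<in> I)"
    "set P \<subseteq> {mark w} \<union> {w \<in> N2. mixed w} \<union>
      {q \<in> N1. \<not> isolated q \<and> (q \<in> I \<longleftrightarrow> mark w \<notin> I)}"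
    by (rule exit_detour[OF m(1) N2_neighbor_not_isolated[OF assms(1) m]])
  have "w \<in> V - D" using assms(1) V disj by auto
  moreover have "w \<notin> set P"
  proof
    assume "w \<in> set P"
    then show False using subsetD[OF P(4)] assms m(1) disj by fastforce
  qed
  ultimately have "exit_path w (w # P) (mark w \<notin> I)"
    using exit_path_Cons[OF P(1), of w] m P(2,3) c_N2_N1[OF m(1) assms(1)] assms(2)
    by (auto simp: insert_commute)
  then show ?thesis using that[of "w # P"] P(4) by auto
qed

section \<open>Connecting pairs of vertices outside \<open>D\<close>\<close>

text \<open>From these vertices \<open>D\<close> can be entered with either new color through at
  most one further outer vertex. The remaining ones, called rigid, need a detour for one of the
  colors.\<close>

definition flexible :: "'a \<Rightarrow> bool" where
  "flexible u \<longleftrightarrow> u \<in> N1 \<and> isolated u \<or> u \<in> N2 \<and> mixed u"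

text \<open>An unmixed vertex of \<open>N2\<close> has neighbors of only one label in
  \<open>N1\<close>, and \<open>mark u\<close> represents it.\<close>

definition label :: "'a \<Rightarrow> bool" where
  "label u \<longleftrightarrow> (if u \<in> N1 then u \<in> I else mark u \<in> I)"

abbreviation labelled :: "bool \<Rightarrow> 'a set" where
  "labelled b \<equiv> {q \<in> N1. \<not> isolated q \<and> (q \<in> I \<longleftrightarrow> b)}"

lemma exit_flexible:
  assumes "flexible u"
  obtains P where "exit_path u P b" "set P \<subseteq> {u} \<union> labelled b"
proof (cases "u \<in> N1")
  case True
  then have "isolated u" using assms disj unfolding flexible_def by auto
  then show ?thesis using that[of "[u]"] exit_direct_isolated[OF True] by simp
next
  case False
  then have u: "u \<in> N2" "mixed u" using assms unfolding flexible_def by auto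
  obtain p where p: "p \<in> N1" "{p, u} \<in> E" "p \<in> I \<longleftrightarrow> b"
    using u(2) unfolding mixed_def by (cases b) auto
  then show ?thesis
    using that[of "[u, p]"] exit_via_unmarked[OF u(1) p(1,2)] u
      N2_neighbor_not_isolated[OF u(1) p(1,2)] by auto
qed

lemma exit_unmixed:
  assumes "u \<in> N2" "\<not> mixed u"
  obtains p where "p \<in> labelled (label u)" "p \<noteq> mark u" "{u, p} \<in> E"
      "exit_path u [u, p] (label u)"
proof -
  obtain p where p: "p \<in> N1" "p \<noteq> mark u" "{p, u} \<in> E" using unmarked[OF assms(1)] by blast
  have "p \<in> I \<longleftrightarrow> mark u \<in> I"
    using assms(2) p mark[OF assms(1)] unfolding mixed_def by blast
  moreover have "u \<notin> N1" using assms(1) disj by auto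
  ultimately show ?thesis
    using that[of p] assms p exit_via_unmarked[OF assms(1) p(1,3)]
      N2_neighbor_not_isolated[OF assms(1) p(1,3)]
    by (auto simp: label_def insert_commute)
qed

lemma exit_rigid_short:
  assumes "u \<in> N1 \<union> N2" "\<not> flexible u"
  obtains P where "exit_path u P (label u)" "set P \<subseteq> {u} \<union> labelled (label u)"
proof (cases "u \<in> N1")
  case True
  then show ?thesis
    using that[of "[u]"] exit_direct[OF True] by (simp add: label_def)
next
  case False
  then have "u \<in> N2" "\<not> mixed u" using assms unfolding flexible_def by auto
  then obtain p where "p \<in> labelled (label u)" "p \<noteq> mark u" "{u, p} \<in> E"
    "exit_path u [u, p] (label u)"
    by (rule exit_unmixed)
  then show ?thesis using that[of "[u, p]"] by simp
qed

text \<open>The vertex bound serves the disjointness arguments: besides \<open>u\<close>, only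
  \<open>mark u\<close> can be a vertex of \<open>N1\<close> on the path with the label of
  \<open>u\<close>.\<close>

lemma exit_rigid_long:
  assumes "u \<in> N1 \<union> N2" "\<not> flexible u"
  obtains P where "exit_path u P (\<not> label u)"
    "set P \<subseteq> {u} \<union> (if u \<in> N2 then {mark u} else {}) \<union> {w \<in> N2. mixed w} \<union> labelled (\<not> label u)"
proof (cases "u \<in> N1")
  case True
  then have "\<not> isolated u" "u \<notin> N2" using assms disj by (auto simp: flexible_def)
  moreover obtain P where "exit_path u P (u \<notin> I)" "tl P \<noteq> []"
    "c {u, hd (tl P)} \<noteq> new_color (u \<in> I)"
    "set P \<subseteq> {u} \<union> {w \<in> N2. mixed w} \<union> labelled (u \<notin> I)"
    using True \<open>\<not> isolated u\<close> by (rule exit_detour)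
  ultimately show ?thesis using that[of P] True by (simp add: label_def)
next
  case False
  then have u: "u \<in> N2" "\<not> mixed u" using assms unfolding flexible_def by auto
  obtain P where "exit_path u P (mark u \<notin> I)"
    "set P \<subseteq> {u, mark u} \<union> {v \<in> N2. mixed v} \<union> labelled (mark u \<notin> I)"
    by (rule exit_via_mark[OF u])
  then show ?thesis using that[of P] u(1) False by (auto simp: label_def)
qed

lemma proper_path_sym: "\<exists>p. proper_path V E c u p v \<Longrightarrow> \<exists>p. proper_path V E c v p u"
  by (elim exE, rule exI) (rule proper_path_rev)

text \<open>A flexible vertex lies in no set \<open>labelled b\<close>. A rigid \<open>v\<close>
  takes its short path, since its long one might pass through a mixed \<open>u\<close>;
  \<open>u\<close> adapts by entering with the other color.\<close>

lemma proper_path_flexible: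
  assumes "u \<in> N1 \<union> N2" "v \<in> N1 \<union> N2" "u \<noteq> v" "flexible u"
  shows "\<exists>p. proper_path V E c u p v"
proof -
  have u: "u \<notin> labelled b" for b using assms(4) disj unfolding flexible_def by auto
  show ?thesis
  proof (cases "flexible v")
    case True
    obtain P where P: "exit_path u P True" "set P \<subseteq> {u} \<union> labelled True"
      by (rule exit_flexible[OF assms(4)])
    obtain Q where Q: "exit_path v Q (\<not> True)" "set Q \<subseteq> {v} \<union> labelled False"
      using exit_flexible[OF True, of False] by auto
    have "v \<notin> labelled b" for b using True disj unfolding flexible_def by auto
    then have "set P \<inter> set Q = {}" using P(2) Q(2) u assms(3) by blast
    then show ?thesis using exit_paths_join[OF P(1) Q(1)] by blast
  next
    case False
    obtain P where P: "exit_path u P (\<not> label v)" "set P \<subseteq> {u} \<union> labelled (\<not> label v)"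
      by (rule exit_flexible[OF assms(4)])
    obtain Q where Q: "exit_path v Q (label v)" "set Q \<subseteq> {v} \<union> labelled (label v)"
      by (rule exit_rigid_short[OF assms(2) False])
    have "v \<notin> labelled (\<not> label v)" by (auto simp: label_def)
    then have "set P \<inter> set Q = {}" using P(2) Q(2) u assms(3) by blast
    then show ?thesis using exit_paths_join[OF P(1)] Q(1) by simp
  qed
qed

text \<open>\<open>u\<close> enters \<open>D\<close> directly and \<open>v\<close> by its long path.
  These can meet only if \<open>u = mark v\<close>, and then \<open>u\<close> and \<open>v\<close>
  are adjacent.\<close>

lemma proper_path_rigid_N1:
  assumes "u \<in> N1" "v \<in> N1 \<union> N2" "u \<noteq> v" "\<not> flexible v" "label u = label v"
  shows "\<exists>p. proper_path V E c u p v"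
proof (cases "v \<in> N2 \<and> mark v = u")
  case True
  then have "{u, v} \<in> E" "u \<in> V" "v \<in> V" using mark[of v] assms V by auto
  then show ?thesis using proper_path_edge assms(3) by metis
next
  case False
  obtain Q where Q: "exit_path v Q (\<not> label v)"
    "set Q \<subseteq> {v} \<union> (if v \<in> N2 then {mark v} else {}) \<union> {w \<in> N2. mixed w} \<union> labelled (\<not> label v)"
    by (rule exit_rigid_long[OF assms(2,4)])
  have "u \<notin> N2" "u \<notin> labelled (\<not> label v)"
    using assms(1,5) disj by (auto simp: label_def)
  then have "set [u] \<inter> set Q = {}" using Q(2) False assms(3) by (auto split: if_splits)
  moreover have "exit_path u [u] (label v)"
    using exit_direct[OF assms(1)] assms(1,5) by (simp add: label_def)
  ultimately show ?thesis using exit_paths_join Q(1) by metis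
qed

lemma proper_path_rigid:
  assumes "u \<in> N1 \<union> N2" "v \<in> N1 \<union> N2" "u \<noteq> v" "\<not> flexible u" "\<not> flexible v"
  shows "\<exists>p. proper_path V E c u p v"
proof (cases "label u = label v")
  case False
  \<comment> \<open>With different labels, the short paths run through oppositely labelled
    vertices.\<close>
  obtain P where P: "exit_path u P (label u)" "set P \<subseteq> {u} \<union> labelled (label u)"
    by (rule exit_rigid_short[OF assms(1,4)])
  obtain Q where Q: "exit_path v Q (label v)" "set Q \<subseteq> {v} \<union> labelled (label v)"
    by (rule exit_rigid_short[OF assms(2,5)])
  have "u \<notin> labelled (label v)" "v \<notin> labelled (label u)"
    using False by (auto simp: label_def)
  then have "set P \<inter> set Q = {}" using P(2) Q(2) assms(3) False by blast
  moreover have "label v = (\<not> label u)" using False by blast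
  ultimately show ?thesis using exit_paths_join[OF P(1)] Q(1) by simp
next
  case same: True
  show ?thesis
  proof (cases "u \<in> N1 \<or> v \<in> N1")
    case True
    then show ?thesis
      using proper_path_rigid_N1 proper_path_sym assms same by metis
  next
    case False
    then have v: "v \<in> N2" "\<not> mixed v" "v \<notin> N1" and u: "u \<in> N2" "\<not> mixed u" "u \<notin> N1"
      using assms unfolding flexible_def by auto
    obtain p where p: "p \<in> labelled (label u)" "p \<noteq> mark u" "{u, p} \<in> E"
      "exit_path u [u, p] (label u)"
      by (rule exit_unmixed[OF u(1,2)])
    show ?thesis
    proof (cases "p = mark v")
      case True
      \<comment> \<open>\<open>p\<close> is unmarked for \<open>u\<close> but marked for
        \<open>v\<close>, so its edges to them have different colors and \<open>u, p, v\<close> is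
        proper.\<close>
      then have "c {u, p} = new_color (\<not> label u)" "c {p, v} = new_color (label u)"
        using p(1,2) u v c_N2_N1[of p u] c_N1_N2[of p v] by auto
      moreover have "{p, v} \<in> E" "p \<notin> N2" using mark[OF v(1)] True disj by auto
      ultimately have "proper_path V E c u [u, p, v] v"
        using p(1,3) u(1) v(1) assms(3) V unfolding proper_path_def is_path_def by auto
      then show ?thesis by blast
    next
      case False
      \<comment> \<open>Here \<open>mark v\<close> is the only vertex of \<open>N1\<close> with the
        common label that \<open>Q\<close> may meet, so \<open>Q\<close> misses \<open>p\<close>. It
        misses \<open>u\<close> because \<open>u\<close> is unmixed.\<close>
      obtain Q where Q: "exit_path v Q (\<not> label v)"
        "set Q \<subseteq> {v} \<union> (if v \<in> N2 then {mark v} else {}) \<union> {w \<in> N2. mixed w} \<union> labelled (\<not> label v)"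
        by (rule exit_rigid_long[OF assms(2,5)])
      have "u \<noteq> mark v" "p \<noteq> v" "p \<notin> N2" using mark[OF v(1)] u v p(1) disj by auto
      then have "set [u, p] \<inter> set Q = {}"
        using Q(2) False u assms(3) p(1) same by (auto split: if_splits)
      then show ?thesis using exit_paths_join[OF p(4)] Q(1) same by simp
    qed
  qed
qed

lemma exit_exists:
  assumes "u \<in> N1 \<union> N2"
  obtains P b where "exit_path u P b"
  using exit_flexible exit_rigid_long[OF assms] by metis

lemma proper_path_coloring_c: "proper_path_coloring V E c"
  unfolding proper_path_coloring_def
proof (intro ballI impI)
  fix u v assume uv: "u \<in> V" "v \<in> V" "u \<noteq> v"
  consider "u \<in> D" "v \<in> D" | "u \<in> D" "v \<in> N1 \<union> N2" | "u \<in> N1 \<union> N2" "v \<in> D"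
    | "u \<in> N1 \<union> N2" "v \<in> N1 \<union> N2"
    using uv V by blast
  then show "\<exists>p. proper_path V E c u p v"
  proof cases
    case 1
    obtain d where "d \<noteq> []" "hd d = u" "last d = v" "distinct d" "set d \<subseteq> D"
      "successively (\<lambda>x y. {x, y} \<in> E) d" "successively (\<lambda>e f. c e \<noteq> c f) (path_edges d)"
      using path_within_D[OF 1] by metis
    then have "proper_path V E c u d v" using V unfolding proper_path_def is_path_def by blast
    then show ?thesis by blast
  next
    case 2
    then show ?thesis using exit_exists exit_path_to_D proper_path_sym by metis
  next
    case 3
    then show ?thesis using exit_exists exit_path_to_D by metis
  next
    case 4
    then show ?thesis
      using proper_path_flexible proper_path_rigid proper_path_sym uv(3) by metis
  qed
qed

end

section \<open>The distance layers of a dominating set\<close>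

theorem theorem3p1:
  fixes V :: "'a set" and E :: "'a set set" and D :: "'a set"
  assumes "fin_simple_graph V E"
    and "connected_graph V E"
    and "connected_two_way_two_step_dominating V E D"
  shows "pc V E \<le> pc D (induced_edges E D) + 2"
proof -
  define N1 N2 where "N1 = nbhd_at V E 1 D" and "N2 = nbhd_at V E 2 D"
  have fin: "finite V" and edge: "\<And>e. e \<in> E \<Longrightarrow> e \<subseteq> V \<and> card e = 2"
    using assms(1) unfolding fin_simple_graph_def by auto
  have D: "D \<subseteq> V" "D \<noteq> {}" and dist: "\<And>v. v \<in> V \<Longrightarrow> set_dist V E v D \<le> 2"
    and pend: "\<And>v. pendant V E v \<Longrightarrow> v \<in> D"
    and two: "\<And>w. w \<in> N2 \<Longrightarrow> 2 \<le> card (neighbors V E w \<inter> N1)"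
    and conn: "connected_graph D (induced_edges E D)"
    using assms(3)
    unfolding connected_two_way_two_step_dominating_def two_way_two_step_dominating_def
      two_step_dominating_def N1_def N2_def by auto
  have finD: "finite D" using D(1) fin by (rule finite_subset)
  have "E \<subseteq> Pow V" using edge by blast
  then have finE: "finite E" using fin by (meson finite_Pow_iff finite_subset)
  have zero: "set_dist V E v D = 0 \<longleftrightarrow> v \<in> D" if "v \<in> V" for v
    using set_dist_eq_0_iff[OF assms(2) finD D(2,1) that] .
  have V: "V = D \<union> N1 \<union> N2"
  proof
    show "V \<subseteq> D \<union> N1 \<union> N2"
    proof
      fix v assume v: "v \<in> V"
      consider "set_dist V E v D = 0" | "set_dist V E v D = 1" | "set_dist V E v D = 2"
        using dist[OF v] by linarith
      then show "v \<in> D \<union> N1 \<union> N2"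
        using zero[OF v] v by cases (auto simp: N1_def N2_def nbhd_at_def)
    qed
  qed (use D in \<open>auto simp: N1_def N2_def nbhd_at_def\<close>)
  have disj: "D \<inter> N1 = {}" "D \<inter> N2 = {}" "N1 \<inter> N2 = {}"
    using zero by (auto simp: N1_def N2_def nbhd_at_def) force+
  have finN1: "finite N1" using fin V by simp
  have no_loop: "u \<noteq> v" if "{u, v} \<in> E" for u v using edge[OF that] by auto
  have "\<exists>x. x \<in> D \<and> {p, x} \<in> E" if p: "p \<in> N1" for p
  proof -
    obtain x where "x \<in> D" "set_dist V E p D = graph_dist V E p x"
      using set_dist_attained[OF finD D(2)] .
    then show ?thesis
      using graph_dist_eq_1_imp_edge[OF assms(2), of p x] p D(1)
      by (auto simp: N1_def nbhd_at_def)
  qed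
  then obtain foot where foot: "\<And>p. p \<in> N1 \<Longrightarrow> foot p \<in> D \<and> {p, foot p} \<in> E" by metis
  have pair: "\<exists>p q. p \<in> N1 \<and> q \<in> N1 \<and> p \<noteq> q \<and> {p, w} \<in> E \<and> {q, w} \<in> E"
    if w: "w \<in> N2" for w
  proof -
    have "finite (neighbors V E w \<inter> N1)" using finN1 by simp
    then obtain p q where "p \<in> neighbors V E w \<inter> N1" "q \<in> neighbors V E w \<inter> N1" "p \<noteq> q"
      using two[OF w] card_le_Suc0_iff_eq[of "neighbors V E w \<inter> N1"] by fastforce
    then show ?thesis by (auto simp: neighbors_def insert_commute)
  qed
  then obtain mark where mark: "\<And>w. w \<in> N2 \<Longrightarrow> mark w \<in> N1 \<and> {mark w, w} \<in> E" by metis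
  have unmarked: "\<exists>p\<in>N1. p \<noteq> mark w \<and> {p, w} \<in> E" if "w \<in> N2" for w
    using pair[OF that] by metis
  have second_foot: "\<exists>x\<in>D. x \<noteq> foot p \<and> {p, x} \<in> E"
    if p: "p \<in> N1" "\<forall>q\<in>N1. \<not> linked E N2 p q" for p
  proof -
    have pV: "p \<in> V" "p \<notin> D" using p(1) V disj by auto
    have "foot p \<in> neighbors V E p" using foot[OF p(1)] D(1) by (auto simp: neighbors_def)
    moreover have "card (neighbors V E p) \<noteq> 1" using pend pV unfolding pendant_def by blast
    ultimately have "neighbors V E p \<noteq> {foot p}" by auto
    then obtain x where x: "x \<in> V" "{p, x} \<in> E" "x \<noteq> foot p"
      using \<open>foot p \<in> neighbors V E p\<close> by (auto simp: neighbors_def)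
    \<comment> \<open>A second neighbor of \<open>p\<close> in \<open>N1\<close> would be linked to
      \<open>p\<close> by an edge, and one in \<open>N2\<close> would link \<open>p\<close> to
      another of its neighbors. So it lies in \<open>D\<close>.\<close>
    have "x \<notin> N1" using p x no_loop unfolding linked_def by blast
    moreover have "x \<notin> N2"
    proof
      assume "x \<in> N2"
      then obtain q where "q \<in> N1" "q \<noteq> p" "{q, x} \<in> E" using pair by metis
      then have "linked E N2 p q" using x(2) \<open>x \<in> N2\<close> unfolding linked_def by metis
      then show False using p(2) \<open>q \<in> N1\<close> by blast
    qed
    ultimately show ?thesis using x V by blast
  qed
  have "linked E N2 p q \<Longrightarrow> linked E N2 q p" "linked E N2 p q \<Longrightarrow> p \<noteq> q" for p q
    unfolding linked_def by (auto simp: insert_commute)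
  then obtain I where split: "\<And>p q. \<lbrakk>p \<in> N1; q \<in> N1; linked E N2 p q\<rbrakk> \<Longrightarrow>
      \<exists>r\<in>N1. linked E N2 p r \<and> (r \<in> I \<longleftrightarrow> p \<notin> I)"
    using splitting_without_monochromatic_neighborhoods[OF finN1, of "linked E N2"] by metis
  have "finite (induced_edges E D)" using finE by (simp add: induced_edges_def)
  then obtain cD where cD: "1 \<le> pc D (induced_edges E D)"
    "cD ` induced_edges E D \<subseteq> {1..pc D (induced_edges E D)}"
    "proper_path_coloring D (induced_edges E D) cD"
    using conn by (rule pc_attained)
  interpret two_layer_coloring V E D N1 N2 I cD "pc D (induced_edges E D)" foot mark
    by unfold_locales (fact V disj foot second_foot split mark unmarked cD)+
  show ?thesis
    by (rule pc_le[OF _ c_range proper_path_coloring_c]) simp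
qed

end
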